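(* If $f\in\mathcal{S}^*$ is a starlike function with logarithmic coefficients $\gamma_1,\gamma_2,\gamma_3,\dots$, then $$|\gamma_1^2-\gamma_2^2|\le\frac54\quad\text{and}\quad|\gamma_2^2-\gamma_3^2|\le\frac{13}{36}.$$
   Context: $\mathbb{D}=\{z\in\mathbb{C}:|z|<1\}$. $\mathcal{S}$ is the class of univalent analytic functions $f$ on $\mathbb{D}$ of the form $f(z)=z+\sum_{n\ge2}a_nz^n$. The logarithmic coefficients $\gamma_n=\gamma_n(f)$ of $f\in\mathcal{S}$ are defined by $\log\frac{f(z)}{z}=2\sum_{n=1}^\infty\gamma_nz^n$, $z\in\mathbb{D}$, where $\log 1=0$. $\mathcal{S}^*$ is the class of $f\in\mathcal{S}$ such that $f(\mathbb{D})$ is starlike with respect to the origin; equivalently, $\operatorname{Re}(zf'(z)/f(z))>0$ for $z\in\mathbb{D}$. *)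

theory Defs
  imports "HOL-Complex_Analysis.Complex_Analysis"
begin

abbreviation unit_disc :: "complex set" where
  "unit_disc \<equiv> ball 0 1"

text \<open>
  Functions on the disc are total functions of type \<^typ>\<open>complex \<Rightarrow> complex\<close> whose values
  outside the disc are irrelevant. The conditions \<open>f 0 = 0\<close> and \<open>deriv f 0 = 1\<close> say that the
  Taylor expansion of \<open>f\<close> at \<open>0\<close> has the form \<open>z + (\<Sum>n\<ge>2. a n * z ^ n)\<close>.
\<close>

definition class_S :: "(complex \<Rightarrow> complex) set" where
  "class_S = {f. f holomorphic_on unit_disc \<and> inj_on f unit_disc \<and> f 0 = 0 \<and> deriv f 0 = 1}"

text \<open>
  The library's \<^const>\<open>starlike\<close> allows an arbitrary star centre; here the centre has to be
  the origin.
\<close>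

definition starlike_wrt_origin :: "complex set \<Rightarrow> bool" where
  "starlike_wrt_origin A \<longleftrightarrow> 0 \<in> A \<and> (\<forall>w\<in>A. closed_segment 0 w \<subseteq> A)"

definition class_S_star :: "(complex \<Rightarrow> complex) set" where
  "class_S_star = {f \<in> class_S. starlike_wrt_origin (f ` unit_disc)}"

text \<open>
  \<open>L\<close> is the single-valued holomorphic branch of \<open>log (f z / z)\<close> on the disc with \<open>log 1 = 0\<close>.
  This is not the principal branch \<^const>\<open>Ln\<close> of \<open>f z / z\<close>, which may be discontinuous.
  The removable singularity at \<open>0\<close>, where \<open>f z / z\<close> tends to \<open>1\<close>, is covered by \<open>L 0 = 0\<close>.
\<close>

definition is_log_quotient :: "(complex \<Rightarrow> complex) \<Rightarrow> (complex \<Rightarrow> complex) \<Rightarrow> bool" where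
  "is_log_quotient f L \<longleftrightarrow>
     L holomorphic_on unit_disc \<and> L 0 = 0 \<and> (\<forall>z\<in>unit_disc - {0}. exp (L z) = f z / z)"

text \<open>
  \<open>\<gamma>\<close> is the sequence of logarithmic coefficients of \<open>f\<close>. The series starts at \<open>n = 1\<close>, so
  \<open>\<gamma> 0\<close> is unconstrained.
\<close>

definition log_coeffs :: "(complex \<Rightarrow> complex) \<Rightarrow> (nat \<Rightarrow> complex) \<Rightarrow> bool" where
  "log_coeffs f \<gamma> \<longleftrightarrow>
     (\<exists>L. is_log_quotient f L \<and>
          (\<forall>z\<in>unit_disc. (\<lambda>n. 2 * (\<gamma> (Suc n) * z ^ Suc n)) sums L z))"

text \<open>Every \<open>f\<close> in the class has logarithmic coefficients.\<close>

lemma log_coeffs_exist: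
  assumes "f \<in> class_S"
  shows "\<exists>\<gamma>. log_coeffs f \<gamma>"
proof -
  have hol: "f holomorphic_on unit_disc" and inj: "inj_on f unit_disc"
    and f0: "f 0 = 0" and df0: "deriv f 0 = 1"
    using assms by (auto simp: class_S_def)
  define q where "q = (\<lambda>z. if z = 0 then 1 else f z / z)"
  have q_hol: "q holomorphic_on unit_disc"
    by (rule pole_theorem_open_0[OF hol, where a = 0]) (auto simp: q_def f0 df0)
  have q_nz: "q z \<noteq> 0" if "z \<in> unit_disc" for z
    using inj_onD[OF inj, of z 0] that f0 by (auto simp: q_def)
  obtain g where g: "g holomorphic_on unit_disc" "\<And>z. z \<in> unit_disc \<Longrightarrow> exp (g z) = q z"
    using simply_connected_eq_holomorphic_log[of unit_disc] q_hol q_nz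
      convex_imp_simply_connected[of unit_disc]
    by (metis convex_ball open_ball)
  define L where "L = (\<lambda>z. g z - g 0)"
  have L_hol: "L holomorphic_on unit_disc"
    unfolding L_def by (intro holomorphic_intros g)
  have "exp (g 0) = 1"
    using g(2)[of 0] by (simp add: q_def)
  then have L: "is_log_quotient f L"
    unfolding is_log_quotient_def using L_hol g(2) by (auto simp: L_def exp_diff q_def)
  define \<gamma> where "\<gamma> = (\<lambda>n. (deriv ^^ n) L 0 / fact n / 2)"
  have "(\<lambda>n. 2 * (\<gamma> (Suc n) * z ^ Suc n)) sums L z" if "z \<in> unit_disc" for z
  proof -
    have "(\<lambda>n. 2 * (\<gamma> n * z ^ n)) sums L z"
      using holomorphic_power_series[OF L_hol that] by (simp add: \<gamma>_def)
    moreover have "\<gamma> 0 = 0"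
      by (simp add: \<gamma>_def L_def)
    ultimately show ?thesis
      using sums_Suc_iff[of "\<lambda>n. 2 * (\<gamma> n * z ^ n)" "L z"] by simp
  qed
  with L show ?thesis
    unfolding log_coeffs_def by blast
qed

end

theory Submission
  imports Defs
begin

text \<open>
  Schwarz's lemma applied to \<open>f\<^sup>-\<^sup>1(t f z)\<close> for \<open>0 \<le> t \<le> 1\<close>, differentiated in \<open>t\<close> at \<open>1\<close>, gives
  \<open>Re (z f' z / f z) \<ge> 0\<close>. Since \<open>z f' z / f z = 1 + \<Sum> 2 n \<gamma>\<^sub>n z\<^sup>n\<close>, Caratheodory's
  coefficient bound yields \<open>\<bar>\<gamma>\<^sub>n\<bar> \<le> 1 / n\<close>, and the theorem follows from the triangle inequality.
\<close>

text \<open>For \<open>z\<close> nonzero, \<open>cnj z * (f z / deriv f z)\<close> is |z|^2 divided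
  by z f'(z) / f(z), so the two have real parts of the same sign. This form avoids dividing by
  \<open>f z\<close> and needs no exception at 0.\<close>

lemma starlike_Re_nonneg:
  assumes "f \<in> class_S_star" and z: "z \<in> unit_disc"
  shows "deriv f z \<noteq> 0" and "0 \<le> Re (cnj z * (f z / deriv f z))"
proof -
  have hol: "f holomorphic_on unit_disc" and inj: "inj_on f unit_disc" and f0: "f 0 = 0"
    and star: "starlike_wrt_origin (f ` unit_disc)"
    using assms by (auto simp: class_S_star_def class_S_def)
  show nz: "deriv f z \<noteq> 0"
    using holomorphic_injective_imp_regular[OF hol _ inj z] by simp
  obtain g where g: "g holomorphic_on f ` unit_disc"
    and dg: "\<And>z. z \<in> unit_disc \<Longrightarrow> deriv f z * deriv g (f z) = 1"
    and gf: "\<And>z. z \<in> unit_disc \<Longrightarrow> g (f z) = z"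
    using holomorphic_has_inverse[OF hol _ inj] by auto
  have op: "open (f ` unit_disc)"
    using open_mapping_thm3[OF hol _ inj] by simp
  have tf: "of_real t * f u \<in> f ` unit_disc" if "u \<in> unit_disc" "0 \<le> t" "t \<le> 1" for t u
    using star that
    unfolding starlike_wrt_origin_def closed_segment_def scaleR_conv_of_real by fastforce
  have contract: "cmod (g (of_real t * f z)) \<le> cmod z" if t: "0 \<le> t" "t \<le> 1" for t
  proof (rule Schwarz_Lemma(1))
    show "(\<lambda>z. g (of_real t * f z)) holomorphic_on unit_disc"
    proof (rule holomorphic_on_compose_gen[OF _ g, unfolded o_def])
      show "(\<lambda>z. of_real t * f z) holomorphic_on unit_disc"
        by (intro holomorphic_intros hol)
      show "(\<lambda>z. of_real t * f z) ` unit_disc \<subseteq> f ` unit_disc"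
        using tf t by blast
    qed
    show "g (of_real t * f 0) = 0"
      using gf[of 0] f0 by simp
    show "cmod (g (of_real t * f u)) < 1" if "cmod u < 1" for u
      using tf[of u t] t that gf by auto
    show "cmod z < 1"
      using z by simp
  qed
  \<comment> \<open>\<open>v\<close> is the velocity at t = 1 of the curve t -> g(t f(z)), which
    reaches \<open>z\<close> at that time.\<close>
  define v where "v = f z * deriv g (f z)"
  have v: "v = f z / deriv f z"
    using dg[OF z] nz by (simp add: v_def field_simps)
  have "(g has_field_derivative deriv g (f z)) (at (of_real 1 * f z))"
    using holomorphic_derivI[OF g op, of "f z"] z by simp
  moreover have "((\<lambda>t. of_real t * f z) has_vector_derivative f z) (at 1)"
    using has_vector_derivative_mult_left[OF has_vector_derivative_of_real[OF DERIV_ident], where a = "f z"]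
    by simp
  ultimately have h: "((\<lambda>t. g (of_real t * f z)) has_vector_derivative v) (at 1)"
    unfolding v_def
    by (drule_tac field_vector_diff_chain_at[rotated]) (auto simp: o_def)
  define k where "k = (\<lambda>t. g (of_real t * f z) \<bullet> g (of_real t * f z))"
  have k: "(k has_real_derivative 2 * (z \<bullet> v)) (at 1)"
    using bounded_bilinear.has_vector_derivative[OF bounded_bilinear_inner h h] gf[OF z]
    by (simp add: k_def has_real_derivative_iff_has_vector_derivative inner_commute)
  have "0 \<le> z \<bullet> v"
  \<comment> \<open>A negative derivative would make \<open>k\<close> exceed \<open>k 1\<close> just
    to the left of 1, against \<open>contract\<close>. The minimum in \<open>e\<close> keeps
    \<open>1 - e\<close> in [0, 1], where \<open>contract\<close> applies.\<close>
  proof (rule ccontr)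
    assume "\<not> 0 \<le> z \<bullet> v"
    then obtain d where d: "d > 0" "\<And>h. 0 < h \<Longrightarrow> h < d \<Longrightarrow> k 1 < k (1 - h)"
      using DERIV_neg_dec_left[OF k] by auto
    define e where "e = min (d / 2) 1"
    have "0 < e" "e < d" "e \<le> 1"
      using d by (auto simp: e_def)
    then have "k 1 < k (1 - e)" "cmod (g (of_real (1 - e) * f z)) \<le> cmod z"
      using d(2)[of e] contract[of "1 - e"] by auto
    then show False
      using gf[OF z] by (simp add: k_def flip: power2_norm_eq_inner)
        (meson norm_ge_zero not_less power_mono)
  qed
  then show "0 \<le> Re (cnj z * (f z / deriv f z))"
    by (simp add: v inner_complex_def del: times_divide_eq_right)
qed

text \<open>The Moebius map w -> w / (w + 2c) fixes 0, has derivative 1 / (2c) there and sends the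
  half-plane Re w > -c into the unit disc, so Schwarz's lemma applies to its composition with
  \<open>Q\<close>. Taking c > 1 turns the weak bound on \<open>Re (Q z)\<close> into the strict one
  required; c then tends to 1.\<close>

lemma deriv_bound_of_Re_ge:
  assumes Q: "Q holomorphic_on unit_disc" "Q 0 = 0"
    and Re: "\<And>z. z \<in> unit_disc \<Longrightarrow> -1 \<le> Re (Q z)"
  shows "cmod (deriv Q 0) \<le> 2"
proof -
  have "cmod (deriv Q 0) \<le> 2 * c" if c: "c > 1" for c :: real
  proof -
    define \<phi> where "\<phi> = (\<lambda>z. Q z / (Q z + 2 * of_real c))"
    have ne: "Q z + 2 * of_real c \<noteq> 0" if "z \<in> unit_disc" for z
      using Re[OF that] c by (auto simp: complex_eq_iff)
    have lt: "cmod (\<phi> z) < 1" if "cmod z < 1" for z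
    proof -
      \<comment> \<open>This product is exactly |Q + 2c|^2 - |Q|^2.\<close>
      have "0 < 4 * c * (Re (Q z) + c)"
        using Re[of z] that c by simp
      then have "(cmod (Q z))\<^sup>2 < (cmod (Q z + 2 * of_real c))\<^sup>2"
        unfolding cmod_power2 by (simp add: power2_eq_square algebra_simps)
      then have "cmod (Q z) < cmod (Q z + 2 * of_real c)"
        by (rule power2_less_imp_less) simp
      then show ?thesis
        using ne[of z] that by (simp add: \<phi>_def norm_divide divide_less_eq)
    qed
    have hol: "\<phi> holomorphic_on unit_disc"
      unfolding \<phi>_def by (intro holomorphic_intros Q ne)
    have "(Q has_field_derivative deriv Q 0) (at 0)"
      using holomorphic_derivI[OF Q(1)] by simp
    then have "(\<phi> has_field_derivative deriv Q 0 / (2 * of_real c)) (at 0)"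
      unfolding \<phi>_def using c Q(2)
      by (auto intro!: derivative_eq_intros simp: field_simps)
    then have "deriv \<phi> 0 = deriv Q 0 / (2 * of_real c)"
      by (rule DERIV_imp_deriv)
    moreover have "cmod (deriv \<phi> 0) \<le> 1"
      using Schwarz_Lemma(2)[OF hol _ lt, of 0] Q(2) by (simp add: \<phi>_def)
    ultimately show ?thesis
      using c by (simp add: norm_divide norm_mult divide_le_eq)
  qed
  note bound = this
  show ?thesis
  proof (rule field_le_epsilon)
    fix e :: real
    assume "0 < e"
    then show "cmod (deriv Q 0) \<le> 2 + e"
      using bound[of "1 + e / 2"] by simp
  qed
qed

text \<open>The summands form a geometric progression whose ratio \<open>w\<close> is itself an n-th
  root of unity, and \<open>w\<close> is 1 exactly when \<open>n\<close> divides
  \<open>m\<close>.\<close>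

lemma sum_roots_of_unity_power:
  assumes "n > 0"
  shows "(\<Sum>k<n. cis (2 * pi * real k / real n) ^ m) = (if n dvd m then of_nat n else 0)"
proof -
  define w where "w = cis (2 * pi * real m / real n)"
  have w: "cis (2 * pi * real k / real n) ^ m = w ^ k" for k
    unfolding w_def Complex.DeMoivre by (rule arg_cong[where f = cis]) (simp add: mult_ac)
  have w1: "w = 1 \<longleftrightarrow> n dvd m"
  proof -
    have "w = 1 \<longleftrightarrow> (\<exists>i::int. 2 * pi * real m / real n = 2 * pi * of_int i)"
      unfolding w_def cis_conv_exp exp_eq_1 by (simp add: mult_ac)
    also have "\<dots> \<longleftrightarrow> (\<exists>i::int. real m = real n * of_int i)"
      using assms by (simp add: field_simps)
    also have "\<dots> \<longleftrightarrow> (\<exists>i::int. int m = int n * i)"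
      by (metis of_int_eq_iff of_int_mult of_int_of_nat_eq)
    also have "\<dots> \<longleftrightarrow> n dvd m"
      by (simp flip: dvd_def)
    finally show ?thesis .
  qed
  have "w ^ n = 1"
    unfolding w_def Complex.DeMoivre using assms by simp
  then show ?thesis
    using w1 by (auto simp: w geometric_sum)
qed

text \<open>
  Averaging \<open>q\<close> over the rotations by \<open>n\<close>-th roots of unity keeps the real part bounded below and
  leaves a power series in \<open>z\<^sup>n\<close>, which reduces the bound to that of a first coefficient.
\<close>

lemma caratheodory_coeff_bound:
  assumes q: "\<And>z. z \<in> unit_disc \<Longrightarrow> (\<lambda>m. c m * z ^ m) sums q z"
    and Re: "\<And>z. z \<in> unit_disc \<Longrightarrow> -1 \<le> Re (q z)"
    and c0: "c 0 = 0" and n: "n > 0"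
  shows "cmod (c n) \<le> 2"
proof -
  define \<omega> where "\<omega> = (\<lambda>k. cis (2 * pi * real k / real n))"
  define A where "A = (\<lambda>z. (\<Sum>k<n. q (\<omega> k * z)) / of_nat n)"
  have rot: "\<omega> k * z \<in> unit_disc" if "z \<in> unit_disc" for k z
    using that by (simp add: \<omega>_def norm_mult)
  have A: "(\<lambda>j. c (n * j) * (z ^ n) ^ j) sums A z" if z: "z \<in> unit_disc" for z
  proof -
    have "(\<lambda>m. (\<Sum>k<n. c m * (\<omega> k * z) ^ m) / of_nat n) sums A z"
      unfolding A_def by (intro sums_divide sums_sum q rot z)
    moreover have "(\<Sum>k<n. c m * (\<omega> k * z) ^ m) / of_nat n = (if n dvd m then c m * z ^ m else 0)" for m
    proof -
      have "(\<Sum>k<n. c m * (\<omega> k * z) ^ m) = c m * z ^ m * (\<Sum>k<n. \<omega> k ^ m)"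
        by (simp add: sum_distrib_left power_mult_distrib mult_ac)
      then show ?thesis
        using n by (simp add: \<omega>_def sum_roots_of_unity_power)
    qed
    ultimately have "(\<lambda>m. if n dvd m then c m * z ^ m else 0) sums A z"
      by simp
    moreover have "strict_mono (\<lambda>j. n * j)"
      using n by (simp add: strict_mono_def)
    ultimately show ?thesis
      by (subst (asm) sums_mono_reindex[of "\<lambda>j. n * j", symmetric]) (auto simp: power_mult)
  qed
  have ReA: "-1 \<le> Re (A z)" if z: "z \<in> unit_disc" for z
  proof -
    have "(\<Sum>k<n. -1) \<le> (\<Sum>k<n. Re (q (\<omega> k * z)))"
      by (intro sum_mono Re rot z)
    then show ?thesis
      using n by (simp add: A_def field_simps)
  qed
  \<comment> \<open>\<open>Q\<close> satisfies A(z) = Q(z^n). Every point of the disc is an n-th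
    power of a point of the disc, so convergence and the lower bound pass from \<open>A\<close> to
    \<open>Q\<close>.\<close>
  define Q where "Q = (\<lambda>w. \<Sum>j. c (n * j) * w ^ j)"
  have Q: "(\<lambda>j. c (n * j) * w ^ j) sums Q w \<and> -1 \<le> Re (Q w)" if w: "w \<in> unit_disc" for w
  proof -
    obtain z where z: "w = z ^ n"
      using n exists_complex_root[of n w] by blast
    then have "z \<in> unit_disc"
      using w n by (simp add: norm_power power_less_one_iff)
    from A[OF this] ReA[OF this] show ?thesis
      by (simp add: Q_def z sums_iff)
  qed
  have hol: "Q holomorphic_on unit_disc"
    using power_series_holomorphic[of 0 1 "\<lambda>j. c (n * j)" Q] Q by simp
  then have "(Q has_field_derivative deriv Q 0) (at 0)"
    by (rule holomorphic_derivI) auto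
  \<comment> \<open>At 0 only the constant term of the differentiated series survives, and it is
    \<open>c n\<close>.\<close>
  then have "(\<lambda>j. diffs (\<lambda>j. c (n * j)) j * 0 ^ j) sums deriv Q 0"
    using Q by (intro termdiffs_sums_strong[of 1 _ Q]) auto
  then have "deriv Q 0 = c n"
    using sums_unique2[OF powser_sums_zero] by (fastforce simp: diffs_def)
  moreover have "Q 0 = 0"
    using c0 by (simp add: Q_def)
  ultimately show ?thesis
    using deriv_bound_of_Re_ge[OF hol] Q by auto
qed

lemma starlike_log_coeff_bound:
  assumes f: "f \<in> class_S_star" and \<gamma>: "log_coeffs f \<gamma>" and n: "n > 0"
  shows "cmod (\<gamma> n) \<le> 1 / real n"
proof -
  obtain L where L: "L holomorphic_on unit_disc" "\<And>z. z \<in> unit_disc - {0} \<Longrightarrow> exp (L z) = f z / z"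
    and sums: "\<And>z. z \<in> unit_disc \<Longrightarrow> (\<lambda>n. 2 * (\<gamma> (Suc n) * z ^ Suc n)) sums L z"
    using \<gamma> by (auto simp: log_coeffs_def is_log_quotient_def)
  have f0: "f 0 = 0"
    using f by (simp add: class_S_star_def class_S_def)
  \<comment> \<open>\<open>\<gamma> 0\<close> is arbitrary, so the constant coefficient is set to
    \<open>L 0 = 0\<close> by hand.\<close>
  define a where "a = (\<lambda>n. if n = 0 then 0 else 2 * \<gamma> n)"
  have La: "(\<lambda>n. a n * z ^ n) sums L z" if "z \<in> unit_disc" for z
    using sums[OF that] sums_Suc_iff[of "\<lambda>n. a n * z ^ n" "L z"] by (simp add: a_def mult.assoc)
  have L': "(L has_field_derivative deriv L z) (at z)" if "z \<in> unit_disc" for z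
    using holomorphic_derivI[OF L(1) open_ball that] .
  have "(\<lambda>m. (of_nat m * a m) * z ^ m) sums (z * deriv L z)" if z: "z \<in> unit_disc" for z
  proof -
    have "(\<lambda>m. diffs a m * z ^ m) sums deriv L z"
      using La z by (intro termdiffs_sums_strong[OF _ L'[OF z]]) auto
    then have "(\<lambda>m. z * (diffs a m * z ^ m)) sums (z * deriv L z)"
      by (rule sums_mult)
    then show ?thesis
      using sums_Suc_iff[of "\<lambda>m. (of_nat m * a m) * z ^ m" "z * deriv L z"]
      by (simp add: diffs_def mult_ac)
  qed
  moreover have "-1 \<le> Re (z * deriv L z)" if z: "z \<in> unit_disc" for z
  proof (cases "z = 0")
    case False
    have fz: "f u = u * exp (L u)" if "u \<in> unit_disc" for u
      using L(2)[of u] that f0 by (cases "u = 0") auto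
    have "((\<lambda>u. u * exp (L u)) has_field_derivative exp (L z) * (1 + z * deriv L z)) (at z)"
      using L'[OF z] by (auto intro!: derivative_eq_intros simp: algebra_simps)
    then have "(f has_field_derivative exp (L z) * (1 + z * deriv L z)) (at z)"
      by (rule has_field_derivative_transform_within_open[OF _ open_ball z]) (simp add: fz)
    then have df: "deriv f z = exp (L z) * (1 + z * deriv L z)"
      by (rule DERIV_imp_deriv)
    \<comment> \<open>Since f(u) = u exp(L(u)), \<open>p\<close> equals z f'(z) / f(z). The earlier
      lemma controls Re(1/p) = Re(p) / |p|^2, which has the sign of Re(p); \<open>p\<close> is
      nonzero because \<open>deriv f z\<close> is.\<close>
    define p where "p = 1 + z * deriv L z"
    have "f z / deriv f z = z / p"
      using fz[OF z] by (simp add: df p_def)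
    then have "0 \<le> Re (cnj z * (z / p))"
      using starlike_Re_nonneg(2)[OF f z] by simp
    also have "cnj z * (z / p) = of_real ((cmod z)\<^sup>2) * inverse p"
      by (simp add: complex_norm_square divide_inverse mult_ac del: of_real_power)
    finally have "0 \<le> Re p * ((cmod z)\<^sup>2 / (cmod p)\<^sup>2)"
      by (simp add: cmod_power2[of p] mult.commute)
    moreover have "0 < (cmod z)\<^sup>2 / (cmod p)\<^sup>2"
      using starlike_Re_nonneg(1)[OF f z] False by (auto simp: df p_def)
    ultimately have "0 \<le> Re p"
      by (meson mult_neg_pos not_le)
    then show ?thesis
      by (simp add: p_def)
  qed simp
  \<comment> \<open>The coefficients of z L'(z) are m a(m), that is 2 m \<gamma>(m) for m >
    0.\<close>
  ultimately have "cmod (of_nat n * a n) \<le> 2"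
    using n by (intro caratheodory_coeff_bound[of "\<lambda>m. of_nat m * a m" "\<lambda>z. z * deriv L z"]) auto
  then show ?thesis
    using n by (simp add: a_def norm_mult field_simps)
qed

theorem corollary2p9:
  fixes f :: "complex \<Rightarrow> complex" and \<gamma> :: "nat \<Rightarrow> complex"
  assumes "f \<in> class_S_star"
    and "log_coeffs f \<gamma>"
  shows "cmod ((\<gamma> 1)\<^sup>2 - (\<gamma> 2)\<^sup>2) \<le> 5 / 4 \<and> cmod ((\<gamma> 2)\<^sup>2 - (\<gamma> 3)\<^sup>2) \<le> 13 / 36"
proof -
  have sq: "(cmod (\<gamma> n))\<^sup>2 \<le> (1 / real n)\<^sup>2" if "n > 0" for n
    by (intro power_mono starlike_log_coeff_bound[OF assms that]) simp
  have "cmod ((\<gamma> m)\<^sup>2 - (\<gamma> n)\<^sup>2) \<le> (1 / real m)\<^sup>2 + (1 / real n)\<^sup>2" if "m > 0" "n > 0" for m n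
    by (rule order_trans[OF norm_triangle_ineq4]) (simp only: norm_power add_mono sq that)
  \<comment> \<open>The constants are 1 + 1/4 = 5/4 and 1/4 + 1/9 = 13/36.\<close>
  from this[of 1 2] this[of 2 3] show ?thesis
    by (simp add: power2_eq_square)
qed

end
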